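(* Let $X$ and $Y$ be random variables following the distributions $\mathrm{CMNB}(r,\nu_1,p)$ and $\mathrm{CMNB}(r,\nu_2,p)$, respectively, where $r,\nu_1,\nu_2\in(0,\infty)$ and $p\in(0,1)$. If $\nu_1\le\nu_2$ and $r\ge 1$, then $X\le_{lr}Y$, and hence $X\le_{st}Y$, $X\le_{hr}Y$ and $X\le_{MLR}Y$.
   Context: For $r,\nu\in(0,\infty)$ and $p\in(0,1)$, a random variable $X$ follows the COM-negative binomial distribution $\mathrm{CMNB}(r,\nu,p)$ if $$\mathrm{P}(X=k)=\left(\frac{\Gamma(r+k)}{k!\,\Gamma(r)}\right)^{\nu}p^k(1-p)^r\frac{1}{C(r,\nu,p)},\quad k=0,1,2,\ldots,\qquad C(r,\nu,p)=\sum_{i=0}^{\infty}\left(\frac{\Gamma(r+i)}{i!\,\Gamma(r)}\right)^{\nu}p^i(1-p)^r .$$ Stochastic orders for discrete random variables $X,Y$ on $\{0,1,2,\ldots\}$ with probability mass functions $f$ and $g$, respectively: (1) usual stochastic order: $X\le_{st}Y$ if $S_X(n)\le S_Y(n)$ for all $n$, where $S_X(n)=\mathrm{P}(X\ge n)$; (2) likelihood ratio order: $X\le_{lr}Y$ if $g(n)/f(n)$ is increasing (in the weak sense) in $n$ over the union of the supports of $X$ and $Y$; (3) hazard rate order: $X\le_{hr}Y$ if $r_X(n)\ge r_Y(n)$ for all $n$, where $r_X(n)=\mathrm{P}(X=n)/\sum_{k\ge n}\mathrm{P}(X=k)$; (4) mean residual life order: $X\le_{MLR}Y$ if $\mu_X(n)\le\mu_Y(n)$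 for all $n$, where $\mu_X(n)=\mathrm{E}(X-n\mid X\ge n)$. *)

theory Defs
  imports "HOL-Probability.Probability"
begin

definition cmnb_weight :: "real \<Rightarrow> real \<Rightarrow> real \<Rightarrow> nat \<Rightarrow> real" where
  "cmnb_weight r \<nu> p k =
     (Gamma (r + real k) / (fact k * Gamma r)) powr \<nu> * p ^ k * (1 - p) powr r"

text \<open>The series converges for all \<open>r, \<nu> > 0\<close> and \<open>0 < p < 1\<close> by the ratio test.\<close>

definition cmnb_const :: "real \<Rightarrow> real \<Rightarrow> real \<Rightarrow> real" where
  "cmnb_const r \<nu> p = (\<Sum>i. cmnb_weight r \<nu> p i)"

definition cmnb_distributed ::
  "'a measure \<Rightarrow> ('a \<Rightarrow> nat) \<Rightarrow> real \<Rightarrow> real \<Rightarrow> real \<Rightarrow> bool" where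
  "cmnb_distributed M X r \<nu> p \<longleftrightarrow>
     distributed M (count_space UNIV) X
       (\<lambda>k. ennreal (cmnb_weight r \<nu> p k / cmnb_const r \<nu> p))"

definition prob_mass :: "'a measure \<Rightarrow> ('a \<Rightarrow> nat) \<Rightarrow> nat \<Rightarrow> real" where
  "prob_mass M X n = \<P>(\<omega> in M. X \<omega> = n)"

definition survival :: "'a measure \<Rightarrow> ('a \<Rightarrow> nat) \<Rightarrow> nat \<Rightarrow> real" where
  "survival M X n = \<P>(\<omega> in M. X \<omega> \<ge> n)"

definition support :: "'a measure \<Rightarrow> ('a \<Rightarrow> nat) \<Rightarrow> nat set" where
  "support M X = {n. prob_mass M X n > 0}"

definition hazard_rate :: "'a measure \<Rightarrow> ('a \<Rightarrow> nat) \<Rightarrow> nat \<Rightarrow> real" where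
  "hazard_rate M X n = prob_mass M X n / (\<Sum>\<^sub>\<infinity>k\<in>{n..}. prob_mass M X k)"

text \<open>The conditional law given \<open>X \<ge> n\<close> is the normalised restriction of \<open>M\<close> to that event,
  on which \<open>X - n\<close> is nonnegative; the value is in \<open>[0, \<infinity>]\<close>, so that an infinite
  mean is not confused with the default value of an undefined integral.\<close>

definition mean_residual_life :: "'a measure \<Rightarrow> ('a \<Rightarrow> nat) \<Rightarrow> nat \<Rightarrow> ennreal" where
  "mean_residual_life M X n =
     (\<integral>\<^sup>+ \<omega>. ennreal (real (X \<omega>) - real n) \<partial>uniform_measure M {\<omega> \<in> space M. X \<omega> \<ge> n})"

definition st_le ::
  "'a measure \<Rightarrow> ('a \<Rightarrow> nat) \<Rightarrow> 'b measure \<Rightarrow> ('b \<Rightarrow> nat) \<Rightarrow> bool" where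
  "st_le M X N Y \<longleftrightarrow> (\<forall>n. survival M X n \<le> survival N Y n)"

text \<open>The ratio is formed in \<open>[0, \<infinity>]\<close>: it is \<open>\<infinity>\<close> at points that carry mass of \<open>Y\<close> but
  not of \<open>X\<close>, and \<open>0 / 0\<close> does not occur on the union of the supports.\<close>

definition lr_le ::
  "'a measure \<Rightarrow> ('a \<Rightarrow> nat) \<Rightarrow> 'b measure \<Rightarrow> ('b \<Rightarrow> nat) \<Rightarrow> bool" where
  "lr_le M X N Y \<longleftrightarrow>
     mono_on (support M X \<union> support N Y)
       (\<lambda>n. ennreal (prob_mass N Y n) / ennreal (prob_mass M X n))"

text \<open>The hazard rate and the mean residual life at \<open>n\<close> are only defined where the survival
  function is positive, so the next two orders compare them at those \<open>n\<close> at which both sides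
  are defined. For variables supported on all of \<open>\<nat>\<close> this is every \<open>n\<close>.\<close>

definition hr_le ::
  "'a measure \<Rightarrow> ('a \<Rightarrow> nat) \<Rightarrow> 'b measure \<Rightarrow> ('b \<Rightarrow> nat) \<Rightarrow> bool" where
  "hr_le M X N Y \<longleftrightarrow>
     (\<forall>n. survival M X n > 0 \<and> survival N Y n > 0 \<longrightarrow> hazard_rate M X n \<ge> hazard_rate N Y n)"

definition mrl_le ::
  "'a measure \<Rightarrow> ('a \<Rightarrow> nat) \<Rightarrow> 'b measure \<Rightarrow> ('b \<Rightarrow> nat) \<Rightarrow> bool" where
  "mrl_le M X N Y \<longleftrightarrow>
     (\<forall>n. survival M X n > 0 \<and> survival N Y n > 0 \<longrightarrow>
        mean_residual_life M X n \<le> mean_residual_life N Y n)"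

end

theory Submission
  imports Defs
begin

text \<open>With \<open>b k = \<Gamma>(r + k) / (k! \<Gamma>(r))\<close>, the ratio of the two probability mass functions is a
  constant multiple of \<open>b k powr (\<nu>2 - \<nu>1)\<close>, and \<open>b (k + 1) / b k = (r + k) / (k + 1) \<ge> 1\<close> exactly
  because \<open>r \<ge> 1\<close>. The likelihood ratio order says \<open>f n * g m \<le> f m * g n\<close> for \<open>m \<le> n\<close>; summing
  over \<open>n\<close> and then over \<open>m\<close> shows that the ratio \<open>S\<^sub>Y / S\<^sub>X\<close> of the survival functions is
  increasing, from which the other orders follow.\<close>

text \<open>Clearing denominators turns the order, stated with possibly infinite ratios on the union
  of the supports, into a real inequality valid at all \<open>m\<close> \<le> \<open>n\<close>,
  which can then be summed.\<close>

lemma lr_le_cross: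
  assumes lr: "lr_le M X N Y" and "m \<le> n"
  shows "prob_mass N Y m * prob_mass M X n \<le> prob_mass M X m * prob_mass N Y n"
proof -
  let ?f = "prob_mass M X" and ?g = "prob_mass N Y"
  let ?U = "support M X \<union> support N Y"
  have nn: "0 \<le> ?f k" "0 \<le> ?g k" for k by (simp_all add: prob_mass_def)
  have out: "?f k = 0 \<and> ?g k = 0" if "k \<notin> ?U" for k
    using that nn[of k] by (auto simp: support_def)
  show ?thesis
  proof (cases "m \<in> ?U \<and> n \<in> ?U \<and> 0 < ?f n")
    case True
    then have ratio: "ennreal (?g m) / ennreal (?f m) \<le> ennreal (?g n) / ennreal (?f n)"
      using lr \<open>m \<le> n\<close> unfolding lr_le_def by (auto elim!: mono_onD)
    have fin: "ennreal (?g n) / ennreal (?f n) = ennreal (?g n / ?f n)"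
      using True nn by (simp add: divide_ennreal)
    \<comment> \<open>Otherwise the ratio would be infinite at \<open>m\<close>, where
      \<open>?g\<close> would carry mass, yet finite at \<open>n\<close> because \<open>?f n\<close>
      is positive.\<close>
    have "0 < ?f m"
    proof (rule ccontr)
      assume "\<not> 0 < ?f m"
      with nn(1)[of m] have fm: "?f m = 0" by linarith
      with True have "0 < ?g m" by (auto simp: support_def)
      with fm ratio show False unfolding fin by (simp add: ennreal_divide_eq_top_iff top_unique)
    qed
    with ratio have "?g m / ?f m \<le> ?g n / ?f n"
      unfolding fin using True nn by (simp add: divide_ennreal)
    with \<open>0 < ?f m\<close> True show ?thesis by (simp add: field_simps)
  next
    \<comment> \<open>Off \<open>?U\<close> both masses vanish, so both sides are 0; if only
      \<open>?f n\<close> vanishes, the left side is 0 and the right side is nonnegative.\<close>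
    case False
    then show ?thesis using nn[of n] nn[of m] out[of m] out[of n] by auto
  qed
qed

lemma survival_Suc:
  assumes "prob_space M" and [measurable]: "X \<in> measurable M (count_space UNIV)"
  shows "survival M X n = prob_mass M X n + survival M X (Suc n)"
proof -
  interpret prob_space M by fact
  have "{\<omega> \<in> space M. n \<le> X \<omega>} = {\<omega> \<in> space M. X \<omega> = n} \<union> {\<omega> \<in> space M. Suc n \<le> X \<omega>}"
    by auto
  then show ?thesis
    unfolding survival_def prob_mass_def by (simp only:) (subst finite_measure_Union; auto)
qed

lemma survival_0: "prob_space M \<Longrightarrow> survival M X 0 = 1"
  by (simp add: survival_def prob_space.prob_space)

lemma prob_mass_sums_survival:
  assumes "prob_space M" and [measurable]: "X \<in> measurable M (count_space UNIV)"
  shows "(\<lambda>k. prob_mass M X (n + k)) sums survival M X n"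
proof -
  interpret prob_space M by fact
  have "(\<lambda>k. prob {\<omega> \<in> space M. X \<omega> = n + k}) sums prob (\<Union>k. {\<omega> \<in> space M. X \<omega> = n + k})"
    by (rule finite_measure_UNION) (auto simp: disjoint_family_on_def)
  moreover have "(\<Union>k. {\<omega> \<in> space M. X \<omega> = n + k}) = {\<omega> \<in> space M. n \<le> X \<omega>}"
    by (auto simp: le_iff_add)
  ultimately show ?thesis by (simp add: prob_mass_def survival_def)
qed

lemma infsum_prob_mass:
  assumes "prob_space M" and "X \<in> measurable M (count_space UNIV)"
  shows "(\<Sum>\<^sub>\<infinity>k\<in>{n..}. prob_mass M X k) = survival M X n"
proof -
  have "((\<lambda>k. prob_mass M X (n + k)) has_sum survival M X n) UNIV"
    by (rule sums_nonneg_imp_has_sum[OF prob_mass_sums_survival[OF assms]])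
       (simp add: prob_mass_def)
  moreover have "range ((+) n) = {n..}"
    by (auto simp: le_iff_add)
  ultimately have "(prob_mass M X has_sum survival M X n) {n..}"
    by (subst (asm) has_sum_reindex[of "(+) n" UNIV, unfolded o_def, symmetric]) auto
  then show ?thesis by (rule infsumI)
qed

text \<open>Tail-sum formula for the expectation of the natural number
  \<open>X \<omega> - n\<close>: the event \<open>t < X \<omega> - n\<close> is
  \<open>n + Suc t \<le> X \<omega>\<close>.\<close>

lemma mean_residual_life_eq:
  assumes "prob_space M" and X[measurable]: "X \<in> measurable M (count_space UNIV)"
    and pos: "0 < survival M X n"
  shows "mean_residual_life M X n = (\<Sum>t. ennreal (survival M X (n + Suc t) / survival M X n))"
proof -
  interpret prob_space M by fact
  let ?A = "{\<omega> \<in> space M. n \<le> X \<omega>}"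
  \<comment> \<open>Both \<open>ennreal\<close> and subtraction on naturals truncate at 0, so the
    identity also holds off \<open>?A\<close>; the indicator of \<open>?A\<close> can therefore be
    dropped below.\<close>
  have int: "ennreal (real (X \<omega>) - real n) = of_nat (X \<omega> - n)" for \<omega>
    by (cases "n \<le> X \<omega>") (auto simp: ennreal_of_nat_eq_real_of_nat ennreal_neg of_nat_diff)
  have "mean_residual_life M X n = (\<integral>\<^sup>+ \<omega>. of_nat (X \<omega> - n) * indicator ?A \<omega> \<partial>M) / emeasure M ?A"
    unfolding mean_residual_life_def int by (rule nn_integral_uniform_measure) auto
  also have "(\<integral>\<^sup>+ \<omega>. of_nat (X \<omega> - n) * indicator ?A \<omega> \<partial>M) = (\<integral>\<^sup>+ \<omega>. of_nat (X \<omega> - n) \<partial>M)"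
    by (rule nn_integral_cong) (auto split: split_indicator)
  also have "\<dots> = (\<Sum>t. emeasure M {\<omega> \<in> space M. t < X \<omega> - n})"
    by (rule nn_integral_nat_function) measurable
  also have "\<dots> = (\<Sum>t. ennreal (survival M X (n + Suc t)))"
    by (auto simp: survival_def emeasure_eq_measure Suc_le_eq less_diff_conv add.commute
             intro!: suminf_cong arg_cong[where f = prob])
  also have "\<dots> / emeasure M ?A = (\<Sum>t. ennreal (survival M X (n + Suc t)) / emeasure M ?A)"
    by (simp add: divide_ennreal_def)
  also have "\<dots> = (\<Sum>t. ennreal (survival M X (n + Suc t) / survival M X n))"
    using pos by (auto simp: survival_def emeasure_eq_measure divide_ennreal intro!: suminf_cong)
  finally show ?thesis .
qed

context
  fixes M :: "'a measure" and N :: "'b measure" and X :: "'a \<Rightarrow> nat" and Y :: "'b \<Rightarrow> nat"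
  assumes M: "prob_space M" and N: "prob_space N"
    and X: "X \<in> measurable M (count_space UNIV)" and Y: "Y \<in> measurable N (count_space UNIV)"
    and lr: "lr_le M X N Y"
begin

lemma lr_le_prob_mass_survival:
  assumes "m \<le> n"
  shows "prob_mass N Y m * survival M X n \<le> prob_mass M X m * survival N Y n"
proof (rule sums_le)
  show "(\<lambda>k. prob_mass N Y m * prob_mass M X (n + k)) sums (prob_mass N Y m * survival M X n)"
    by (intro sums_mult prob_mass_sums_survival M X)
  show "(\<lambda>k. prob_mass M X m * prob_mass N Y (n + k)) sums (prob_mass M X m * survival N Y n)"
    by (intro sums_mult prob_mass_sums_survival N Y)
  show "prob_mass N Y m * prob_mass M X (n + k) \<le> prob_mass M X m * prob_mass N Y (n + k)" for k
    using assms by (intro lr_le_cross[OF lr]) simp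
qed

lemma lr_le_survival_cross:
  assumes "m \<le> n"
  shows "survival N Y m * survival M X n \<le> survival M X m * survival N Y n"
  using assms
\<comment> \<open>Downward induction from \<open>m = n\<close>, where both sides agree; each step
  adds the inequality for the mass at \<open>m\<close> to the one for the survival functions at
  \<open>Suc m\<close>.\<close>
proof (induction m rule: inc_induct)
  case (step m)
  with lr_le_prob_mass_survival[of m n] show ?case
    by (simp add: survival_Suc[OF M X, of m] survival_Suc[OF N Y, of m] algebra_simps)
qed simp

lemma lr_le_imp_st_le: "st_le M X N Y"
  unfolding st_le_def
  \<comment> \<open>At 0 both survival functions equal 1, so only the comparison at \<open>n\<close>
    remains.\<close>
  using lr_le_survival_cross[of 0] by (simp add: survival_0 M N)

lemma lr_le_imp_hr_le: "hr_le M X N Y"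
  unfolding hr_le_def hazard_rate_def
  using lr_le_prob_mass_survival[OF order_refl]
  by (auto simp: infsum_prob_mass M N X Y field_simps)

text \<open>The tail-sum series compare term by term: \<open>lr_le_survival_cross\<close> between
  \<open>n\<close> and \<open>n + Suc t\<close>, divided by the two survival functions at
  \<open>n\<close>.\<close>

lemma lr_le_imp_mrl_le: "mrl_le M X N Y"
  unfolding mrl_le_def
proof (intro allI impI)
  fix n assume pos: "survival M X n > 0 \<and> survival N Y n > 0"
  show "mean_residual_life M X n \<le> mean_residual_life N Y n"
    using pos
    by (auto simp: mean_residual_life_eq M N X Y field_simps
             intro!: suminf_le ennreal_leI lr_le_survival_cross)
qed

end

lemma binomial_ratio_mono:
  fixes r :: real
  assumes "1 \<le> r"
  shows "mono (\<lambda>k. Gamma (r + real k) / (fact k * Gamma r))"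
proof (rule monoI, rule lift_Suc_mono_le)
  fix k
  have pos: "0 < Gamma (r + real k)" "0 < Gamma r"
    using assms by (auto intro!: Gamma_real_pos)
  have "Gamma (r + real (Suc k)) = (r + real k) * Gamma (r + real k)"
    using assms Gamma_plus1[of "r + real k"] nonpos_Ints_nonpos[of "r + real k"]
    by (force simp: add_ac)
  then have "Gamma (r + real (Suc k)) / (fact (Suc k) * Gamma r)
      = (r + real k) / real (Suc k) * (Gamma (r + real k) / (fact k * Gamma r))"
    by simp
  moreover have "1 \<le> (r + real k) / real (Suc k)" using assms by simp
  ultimately show "Gamma (r + real k) / (fact k * Gamma r)
      \<le> Gamma (r + real (Suc k)) / (fact (Suc k) * Gamma r)"
    using pos mult_right_mono[of 1 "(r + real k) / real (Suc k)" "Gamma (r + real k) / (fact k * Gamma r)"]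
    by simp
qed

text \<open>Positivity of the constant is read off from the total mass instead of the convergence of
  the series: were it nonpositive, the density would vanish identically.\<close>

lemma cmnb_distributed_prob_mass:
  assumes "prob_space M" and dist: "cmnb_distributed M X r \<nu> p" and p: "0 < p" "p < 1"
  shows "0 < cmnb_const r \<nu> p"
    and "prob_mass M X k = cmnb_weight r \<nu> p k / cmnb_const r \<nu> p"
proof -
  interpret prob_space M by fact
  let ?d = "\<lambda>k. cmnb_weight r \<nu> p k / cmnb_const r \<nu> p"
  note D = dist[unfolded cmnb_distributed_def]
  have w: "0 \<le> cmnb_weight r \<nu> p k" for k using p by (simp add: cmnb_weight_def)
  show c: "0 < cmnb_const r \<nu> p"
  proof (rule ccontr)
    assume "\<not> 0 < cmnb_const r \<nu> p"
    \<comment> \<open>A negative constant makes the quotient nonpositive, which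
      \<open>ennreal\<close> sends to 0; a zero constant gives 0 by the convention for division by
      zero.\<close>
    then have "ennreal (?d k) = 0" for k
      using w[of k] by (simp add: ennreal_eq_0_iff divide_nonneg_nonpos)
    then have "emeasure M (space M) = 0"
      using distributed_emeasure[OF D, of UNIV] by simp
    then show False by (simp add: emeasure_space_1)
  qed
  have "emeasure M (X -` {k} \<inter> space M) = ennreal (?d k)"
    using distributed_emeasure[OF D, of "{k}"]
    by (simp add: nn_integral_count_space_indicator[symmetric])
  moreover have "X -` {k} \<inter> space M = {\<omega> \<in> space M. X \<omega> = k}" by auto
  ultimately show "prob_mass M X k = ?d k"
    using c w[of k] by (simp add: prob_mass_def emeasure_eq_measure)
qed

theorem theorem2p2:
  fixes M :: "'a measure" and N :: "'b measure"
    and X :: "'a \<Rightarrow> nat" and Y :: "'b \<Rightarrow> nat"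
    and r \<nu>1 \<nu>2 p :: real
  assumes "prob_space M" and "prob_space N"
    and "0 < r" and "0 < \<nu>1" and "0 < \<nu>2" and "0 < p" and "p < 1"
    and "cmnb_distributed M X r \<nu>1 p" and "cmnb_distributed N Y r \<nu>2 p"
    and "\<nu>1 \<le> \<nu>2" and "1 \<le> r"
  shows "lr_le M X N Y \<and> st_le M X N Y \<and> hr_le M X N Y \<and> mrl_le M X N Y"
proof -
  define b where "b k = Gamma (r + real k) / (fact k * Gamma r)" for k
  note massX = cmnb_distributed_prob_mass[OF assms(1,8,6,7)]
  note massY = cmnb_distributed_prob_mass[OF assms(2,9,6,7)]
  have b_pos: "0 < b k" for k
    unfolding b_def using \<open>0 < r\<close> by (auto intro!: divide_pos_pos mult_pos_pos Gamma_real_pos)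
  have weight: "cmnb_weight r \<nu> p k = b k powr \<nu> * (p ^ k * (1 - p) powr r)" for \<nu> k
    by (simp add: cmnb_weight_def b_def)
  have weight_pos: "0 < cmnb_weight r \<nu> p k" for \<nu> k
    using b_pos[of k] assms(6,7) by (simp add: weight)
  let ?q = "cmnb_const r \<nu>1 p / cmnb_const r \<nu>2 p"
  \<comment> \<open>The factor \<open>p ^ k * (1 - p) powr r\<close> cancels. Both masses are
    positive at every \<open>k\<close>, so the ratio is always finite.\<close>
  have ratio: "ennreal (prob_mass N Y k) / ennreal (prob_mass M X k)
      = ennreal (?q * b k powr (\<nu>2 - \<nu>1))" for k
  proof -
    have "cmnb_weight r \<nu>2 p k / cmnb_weight r \<nu>1 p k = b k powr (\<nu>2 - \<nu>1)"
      using assms(6,7) by (simp add: weight powr_diff)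
    then have "prob_mass N Y k / prob_mass M X k = ?q * b k powr (\<nu>2 - \<nu>1)"
      by (simp add: massX(2) massY(2) flip: \<open>_ = b k powr _\<close>)
    moreover have "0 < prob_mass N Y k" "0 < prob_mass M X k"
      using massX(1) massY(1) weight_pos by (simp_all add: massX(2) massY(2))
    ultimately show ?thesis by (simp add: divide_ennreal)
  qed
  have lr: "lr_le M X N Y"
    unfolding lr_le_def ratio
  proof (rule mono_onI)
    fix m n :: nat assume "m \<le> n"
    then have "b m \<le> b n"
      using binomial_ratio_mono[OF \<open>1 \<le> r\<close>] by (simp add: b_def mono_def)
    \<comment> \<open>The exponent is nonnegative because \<open>\<nu>1 \<le> \<nu>2\<close>, so the
      power preserves the order.\<close>
    then have "b m powr (\<nu>2 - \<nu>1) \<le> b n powr (\<nu>2 - \<nu>1)"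
      using b_pos[of m] \<open>\<nu>1 \<le> \<nu>2\<close> by (intro powr_mono2) auto
    then show "ennreal (?q * b m powr (\<nu>2 - \<nu>1)) \<le> ennreal (?q * b n powr (\<nu>2 - \<nu>1))"
      using massX(1) massY(1) by (intro ennreal_leI mult_left_mono) auto
  qed
  have "X \<in> measurable M (count_space UNIV)" "Y \<in> measurable N (count_space UNIV)"
    using assms(8,9) unfolding cmnb_distributed_def by (auto dest: distributed_measurable)
  note hyps = assms(1,2) this lr
  show ?thesis
    using lr lr_le_imp_st_le[OF hyps] lr_le_imp_hr_le[OF hyps] lr_le_imp_mrl_le[OF hyps] by blast
qed

end
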